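(* There exist $2^{\aleph_0}$ different associative spectra; that is, the set of all sequences of natural numbers that arise as the associative spectrum $(s_n(\mathbf{A}))_{n\in\mathbb{N}}$ of some $p$-ary groupoid $\mathbf{A}$ (for some $p\ge2$) has cardinality $2^{\aleph_0}$.
   Context: $\mathbb{N}$ includes $0$. For an integer $p\ge2$, the set $T$ of $p$-ary bracketings consists of the terms (prefix notation) over the single variable $x$ and the $p$-ary operation symbol $\omega$, i.e. $x\in T$, and $\omega t_1\ldots t_p\in T$ whenever $t_1,\ldots,t_p\in T$. $B_n^{(p)}$ is the set of bracketings with exactly $n$ occurrences of $\omega$. $\varepsilon_1(t)$ is the term obtained from $t$ by replacing the occurrences of $x$, from left to right, by distinct variables $x_1,x_2,\ldots$. For a $p$-ary groupoid $\mathbf{A}$ (an algebra with one $p$-ary operation), $\sigma_n(\mathbf{A})$ is the equivalence relation on $B_n^{(p)}$ consisting of all $(s,t)$ such that $\mathbf{A}$ satisfies the identity $\varepsilon_1(s)\approx\varepsilon_1(t)$, and the associative spectrum of $\mathbf{A}$ is the sequence $s_n(\mathbf{A})=|B_n^{(p)}/\sigma_n(\mathbf{A})|$, $n\in\mathbb{N}$. *)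

theory Defs
  imports Main "HOL-Library.Equipollence" "HOL-Library.Countable_Set"
begin

datatype 'v trm = Var 'v | Op "'v trm list"

inductive_set terms :: "nat \<Rightarrow> 'v trm set" for p :: nat where
  Var: "Var v \<in> terms p"
| Op: "length ts = p \<Longrightarrow> (\<forall>t\<in>set ts. t \<in> terms p) \<Longrightarrow> Op ts \<in> terms p"

text \<open>The single variable of a bracketing is the unique element of type \<^typ>\<open>unit\<close>.\<close>

type_synonym bracketing = "unit trm"

abbreviation bracketings :: "nat \<Rightarrow> bracketing set"
  where "bracketings p \<equiv> terms p"

primrec num_ops :: "'v trm \<Rightarrow> nat" where
  "num_ops (Var v) = 0"
| "num_ops (Op ts) = Suc (sum_list (map num_ops ts))"

primrec num_vars :: "'v trm \<Rightarrow> nat" where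
  "num_vars (Var v) = 1"
| "num_vars (Op ts) = sum_list (map num_vars ts)"

definition bracketings_of_size :: "nat \<Rightarrow> nat \<Rightarrow> bracketing set" where
  "bracketings_of_size p n = {t \<in> bracketings p. num_ops t = n}"

text \<open>\<open>label k t\<close> replaces the variable occurrences of \<open>t\<close>, from left to right,
  by \<open>k\<close>, \<open>k + 1\<close>, \<open>k + 2\<close>, and so on.\<close>

fun label :: "nat \<Rightarrow> 'v trm \<Rightarrow> nat trm"
  and label_list :: "nat \<Rightarrow> 'v trm list \<Rightarrow> nat trm list" where
  "label k (Var v) = Var k"
| "label k (Op ts) = Op (label_list k ts)"
| "label_list k [] = []"
| "label_list k (t # ts) = label k t # label_list (k + num_vars t) ts"

definition eps1 :: "bracketing \<Rightarrow> nat trm" where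
  "eps1 t = label 1 t"

text \<open>The operation is a function on lists of which only the values on lists of
  length \<open>p\<close> over the carrier matter.\<close>

definition groupoid :: "nat \<Rightarrow> 'a set \<Rightarrow> ('a list \<Rightarrow> 'a) \<Rightarrow> bool" where
  "groupoid p A f \<longleftrightarrow> A \<noteq> {} \<and> (\<forall>as. length as = p \<and> set as \<subseteq> A \<longrightarrow> f as \<in> A)"

primrec eval_trm :: "('a list \<Rightarrow> 'a) \<Rightarrow> ('v \<Rightarrow> 'a) \<Rightarrow> 'v trm \<Rightarrow> 'a" where
  "eval_trm f h (Var v) = h v"
| "eval_trm f h (Op ts) = f (map (eval_trm f h) ts)"

definition satisfies :: "'a set \<Rightarrow> ('a list \<Rightarrow> 'a) \<Rightarrow> 'v trm \<Rightarrow> 'v trm \<Rightarrow> bool" where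
  "satisfies A f s t \<longleftrightarrow> (\<forall>h. range h \<subseteq> A \<longrightarrow> eval_trm f h s = eval_trm f h t)"

definition sigma :: "nat \<Rightarrow> 'a set \<Rightarrow> ('a list \<Rightarrow> 'a) \<Rightarrow> nat \<Rightarrow> (bracketing \<times> bracketing) set" where
  "sigma p A f n =
    {(s, t). s \<in> bracketings_of_size p n \<and> t \<in> bracketings_of_size p n \<and>
             satisfies A f (eps1 s) (eps1 t)}"

definition spectrum :: "nat \<Rightarrow> 'a set \<Rightarrow> ('a list \<Rightarrow> 'a) \<Rightarrow> nat \<Rightarrow> nat" where
  "spectrum p A f n = card (bracketings_of_size p n // sigma p A f n)"

text \<open>HOL cannot quantify existentially over types, so the spectra are collected for the
  groupoids whose carrier is a subset of a given type. Lemma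
  \<open>associative_spectra_subset\<close> below shows that, as soon as this type is infinite,
  these are all the spectra of groupoids over any type.\<close>

definition associative_spectra :: "'a itself \<Rightarrow> (nat \<Rightarrow> nat) set" where
  "associative_spectra _ =
    {spectrum p A f | p (A :: 'a set) (f :: 'a list \<Rightarrow> 'a). p \<ge> 2 \<and> groupoid p A f}"

lemma equiv_sigma: "equiv (bracketings_of_size p n) (sigma p A f n)"
  by (auto intro!: equivI refl_onI symI transI simp: sigma_def satisfies_def)

lemma finite_bracketings_of_size: "finite (bracketings_of_size p n)"
proof (induction n rule: less_induct)
  case (less n)
  let ?S = "\<Union>m<n. bracketings_of_size p m"
  have fin: "finite {ts. set ts \<subseteq> ?S \<and> length ts = p}"
    by (rule finite_lists_length_eq) (use less in auto)
  have "bracketings_of_size p n \<subseteq> insert (Var ()) (Op ` {ts. set ts \<subseteq> ?S \<and> length ts = p})"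
  proof
    fix t assume "t \<in> bracketings_of_size p n"
    then have t: "t \<in> bracketings p" "num_ops t = n"
      by (auto simp: bracketings_of_size_def)
    from t(1) show "t \<in> insert (Var ()) (Op ` {ts. set ts \<subseteq> ?S \<and> length ts = p})"
    proof cases
      case (Op ts)
      have "u \<in> ?S" if "u \<in> set ts" for u
        using Op t(2) member_le_sum_list[of "num_ops u" "map num_ops ts"] that
        by (auto simp: bracketings_of_size_def)
      with Op show ?thesis by auto
    qed simp
  qed
  with fin show ?case by (meson finite_imageI finite_insert finite_subset)
qed

instance trm :: (countable) countable
  by countable_datatype

lemma length_label_list: "length (label_list k ts) = length ts"
  by (induction ts arbitrary: k) auto

lemma label_list_subset:
  assumes "\<forall>t\<in>set ts. \<forall>k. label k t \<in> S"
  shows "set (label_list k ts) \<subseteq> S"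
  using assms by (induction ts arbitrary: k) auto

lemma label_in_terms:
  assumes "t \<in> terms p" shows "label k t \<in> terms p"
  using assms
proof (induction arbitrary: k)
  case (Op ts)
  then have "set (label_list k ts) \<subseteq> terms p"
    by (intro label_list_subset) auto
  with Op show ?case by (auto intro!: terms.Op simp: length_label_list)
qed (auto intro: terms.Var)

lemma eval_trm_in_carrier:
  assumes "t \<in> terms p" "groupoid p A f" "range h \<subseteq> A"
  shows "eval_trm f h t \<in> A"
  using assms(1)
proof induction
  case (Op ts)
  then have "length (map (eval_trm f h) ts) = p \<and> set (map (eval_trm f h) ts) \<subseteq> A" by auto
  with assms(2) show ?case unfolding groupoid_def by fastforce
qed (use assms in auto)

lemma spectrum_cong:
  assumes "\<And>s t :: nat trm. s \<in> terms p \<Longrightarrow> t \<in> terms p \<Longrightarrow> satisfies A f s t \<longleftrightarrow> satisfies B g s t"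
  shows "spectrum p A f = spectrum p B g"
proof -
  have "sigma p A f n = sigma p B g n" for n
    using assms by (auto simp: sigma_def bracketings_of_size_def eps1_def label_in_terms)
  then show ?thesis by (auto simp: spectrum_def)
qed

lemma countable_subgroupoid:
  fixes A :: "'b set"
  assumes "groupoid p A f"
  obtains C where "countable C" "groupoid p C f"
    "\<And>s t :: nat trm. satisfies A f s t \<longleftrightarrow> satisfies C f s t"
proof -
  obtain a where a: "a \<in> A" using assms by (auto simp: groupoid_def)
  define P where "P = (\<lambda>(s, t) (h :: nat \<Rightarrow> 'b).
    range h \<subseteq> A \<and> (\<not> satisfies A f s t \<longrightarrow> eval_trm f h s \<noteq> eval_trm f h t))"
  have "\<exists>h. P st h" for st
  proof (cases "satisfies A f (fst st) (snd st)")
    case True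
    then show ?thesis using a by (intro exI[of _ "\<lambda>_. a"]) (auto simp: P_def split: prod.split)
  next
    case False
    then show ?thesis by (auto simp: P_def satisfies_def split: prod.split) metis
  qed
  then obtain w where w: "\<And>st. P st (w st)" by metis
  define g where "g = (\<lambda>(st, i). w st i)"
  have gA: "range g \<subseteq> A" using w by (fastforce simp: g_def P_def)
  define C where "C = eval_trm f g ` terms p"
  have sub: "C \<subseteq> A" using eval_trm_in_carrier[OF _ assms gA] by (auto simp: C_def)
  have gC: "g x \<in> C" for x
    unfolding C_def by (rule image_eqI[of _ _ "Var x"]) (auto intro: terms.Var)
  have wC: "range (w st) \<subseteq> C" for st
    using gC[of "(st, i)" for i] by (auto simp: g_def)
  have "groupoid p C f"
    unfolding groupoid_def
  proof (intro conjI allI impI)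
    show "C \<noteq> {}" using wC by blast
    fix as assume as: "length as = p \<and> set as \<subseteq> C"
    then have "as \<in> lists (eval_trm f g ` terms p)" by (auto simp: C_def)
    then obtain ts where ts: "as = map (eval_trm f g) ts" "set ts \<subseteq> terms p"
      unfolding lists_image by auto
    then show "f as \<in> C" unfolding C_def
      using as by (intro image_eqI[of _ _ "Op ts"]) (auto intro!: terms.Op)
  qed
  moreover have "satisfies A f s t \<longleftrightarrow> satisfies C f s t" for s t :: "nat trm"
  proof
    show "satisfies A f s t \<Longrightarrow> satisfies C f s t" using sub by (force simp: satisfies_def)
    show "satisfies C f s t \<Longrightarrow> satisfies A f s t"
      using w[of "(s, t)"] wC[of "(s, t)"] by (auto simp: satisfies_def P_def)
  qed
  moreover have "countable C" by (simp add: C_def)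
  ultimately show ?thesis using that by blast
qed

lemma groupoid_transport:
  fixes e :: "'b \<Rightarrow> 'a"
  assumes G: "groupoid p C f" and inj: "inj_on e C"
  defines "g \<equiv> \<lambda>as. e (f (map (inv_into C e) as))"
  shows "groupoid p (e ` C) g"
    and "\<And>s t :: nat trm. s \<in> terms p \<Longrightarrow> t \<in> terms p \<Longrightarrow>
           satisfies C f s t \<longleftrightarrow> satisfies (e ` C) g s t"
proof -
  show "groupoid p (e ` C) g"
    unfolding groupoid_def
  proof (intro conjI allI impI)
    show "e ` C \<noteq> {}" using G by (auto simp: groupoid_def)
    fix as assume as: "length as = p \<and> set as \<subseteq> e ` C"
    then have "set (map (inv_into C e) as) \<subseteq> C" by (auto intro: inv_into_into)
    with as G show "g as \<in> e ` C" unfolding g_def groupoid_def by (metis imageI length_map)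
  qed
  have ev: "eval_trm g (\<lambda>x. e (h x)) t = e (eval_trm f h t)"
    if "t \<in> terms p" "range h \<subseteq> C" for t :: "nat trm" and h
    using that(1)
  proof induction
    case (Op ts)
    have "map (inv_into C e) (map (eval_trm g (\<lambda>x. e (h x))) ts) = map (eval_trm f h) ts"
      using Op eval_trm_in_carrier[OF _ G that(2)] inj by auto
    then show ?case by (simp add: g_def del: map_map)
  qed simp
  fix s t :: "nat trm" assume st: "s \<in> terms p" "t \<in> terms p"
  show "satisfies C f s t \<longleftrightarrow> satisfies (e ` C) g s t"
  proof
    assume L: "satisfies C f s t"
    show "satisfies (e ` C) g s t"
      unfolding satisfies_def
    proof (intro allI impI)
      fix k :: "nat \<Rightarrow> 'a" assume k: "range k \<subseteq> e ` C"
      define h where "h = (\<lambda>x. inv_into C e (k x))"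
      have h: "range h \<subseteq> C" using k by (auto simp: h_def intro!: inv_into_into)
      have "k = (\<lambda>x. e (h x))" using k by (auto simp: h_def f_inv_into_f image_subset_iff)
      with ev[OF st(1) h] ev[OF st(2) h] L h show "eval_trm g k s = eval_trm g k t"
        by (simp add: satisfies_def)
    qed
  next
    assume R: "satisfies (e ` C) g s t"
    show "satisfies C f s t"
      unfolding satisfies_def
    proof (intro allI impI)
      fix h :: "nat \<Rightarrow> 'b" assume h: "range h \<subseteq> C"
      then have "eval_trm g (\<lambda>x. e (h x)) s = eval_trm g (\<lambda>x. e (h x)) t"
        using R by (auto simp: satisfies_def image_subset_iff)
      then have "e (eval_trm f h s) = e (eval_trm f h t)"
        by (simp add: ev[OF st(1) h] ev[OF st(2) h])
      then show "eval_trm f h s = eval_trm f h t"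
        using inj eval_trm_in_carrier[OF st(1) G h] eval_trm_in_carrier[OF st(2) G h]
        by (auto dest: inj_onD)
    qed
  qed
qed

lemma associative_spectra_subset:
  assumes "infinite (UNIV :: 'a set)"
  shows "associative_spectra TYPE('b) \<subseteq> associative_spectra TYPE('a)"
proof
  fix q assume "q \<in> associative_spectra TYPE('b)"
  then obtain p f and A :: "'b set"
    where q: "q = spectrum p A f" "p \<ge> 2" "groupoid p A f"
    by (auto simp: associative_spectra_def)
  obtain C where C: "countable C" "groupoid p C f"
    "\<And>s t :: nat trm. satisfies A f s t \<longleftrightarrow> satisfies C f s t"
    using countable_subgroupoid[OF q(3)] by blast
  obtain c :: "nat \<Rightarrow> 'a" where "inj c"
    using assms infinite_countable_subset by blast
  then have inj: "inj_on (c \<circ> to_nat_on C) C"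
    using C(1) by (intro comp_inj_on inj_on_to_nat_on) (auto intro: inj_on_subset)
  note tr = groupoid_transport[OF C(2) inj]
  have "q = spectrum p ((c \<circ> to_nat_on C) ` C)
              (\<lambda>as. (c \<circ> to_nat_on C) (f (map (inv_into C (c \<circ> to_nat_on C)) as)))"
    unfolding q(1) by (rule spectrum_cong) (use C(3) tr(2) in blast)
  with q(2) tr(1) show "q \<in> associative_spectra TYPE('a)"
    unfolding associative_spectra_def by blast
qed

end

(* Let every term that contains a forbidden pattern evaluate to an absorbing element, and let
  all other terms evaluate freely. Two bracketings of the same size are then identified iff
  they are equal or both contain a forbidden pattern. The forbidden patterns are (xx)(xx) and,
  for d in a given set S of natural numbers, the comb that goes once to the right, d times to
  the left, and once to the right again. These combs form an antichain under containment, and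
  the d-th one has d + 3 operation symbols. So if d is the least element of the symmetric
  difference of S and S', then among the bracketings of size d + 3 exactly one more, namely
  the d-th comb itself, is forbidden for the set that contains d. The spectra differ there. *)

theory Submission imports Defs "HOL-Library.Nat_Bijection" begin

text \<open>Side branches are arbitrary and the final \<open>Op us\<close> only has to be composite,
  so this covers all substitution instances of the pattern.\<close>

inductive left_spine :: "nat \<Rightarrow> 'v trm \<Rightarrow> bool" where
  left_spine_0: "left_spine 0 (Op [a, Op us])"
| left_spine_Suc: "left_spine d a \<Longrightarrow> left_spine (Suc d) (Op [a, b])"

text \<open>The term \<^term>\<open>Op []\<close> serves as the absorbing element; it does not occur in bracketings.\<close>

inductive forbidden :: "nat set \<Rightarrow> 'v trm \<Rightarrow> bool" for S :: "nat set" where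
  zero: "forbidden S (Op [])"
| branch: "forbidden S (Op [Op us, Op vs])"
| comb: "d \<in> S \<Longrightarrow> left_spine d u \<Longrightarrow> forbidden S (Op [a, u])"
| left: "forbidden S a \<Longrightarrow> forbidden S (Op [a, b])"
| right: "forbidden S b \<Longrightarrow> forbidden S (Op [a, b])"

inductive_cases left_spine_VarE: "left_spine d (Var v)"
inductive_cases left_spine_OpE: "left_spine d (Op [a, b])"
inductive_cases forbidden_VarE: "forbidden S (Var v)"
inductive_cases forbidden_OpE: "forbidden S (Op [a, b])"

lemma left_spine_subst: "left_spine d t \<Longrightarrow> left_spine d (eval_trm Op h t)"
  by (induction rule: left_spine.induct) (auto intro: left_spine.intros)

lemma forbidden_subst: "forbidden S t \<Longrightarrow> forbidden S (eval_trm Op h t)"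
  by (induction rule: forbidden.induct) (auto intro: forbidden.intros left_spine_subst)

lemma left_spine_label: "left_spine d t \<Longrightarrow> left_spine d (label k t)"
  by (induction arbitrary: k rule: left_spine.induct) (auto intro: left_spine.intros)

lemma forbidden_label: "forbidden S t \<Longrightarrow> forbidden S (label k t)"
  by (induction arbitrary: k rule: forbidden.induct)
    (auto intro: forbidden.intros left_spine_label)

lemma num_ops_left_spine: "left_spine d t \<Longrightarrow> d + 2 \<le> num_ops t"
  by (induction rule: left_spine.induct) auto

text \<open>A comb of index \<open>e\<close> takes at least \<open>e + 3\<close> operation symbols,
  so only indices \<open>e \<le> d\<close> fit into the term.\<close>

lemma forbidden_mono_upto:
  assumes "forbidden S t" "num_ops t \<le> d + 3" "S \<inter> {..d} \<subseteq> S'"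
  shows "forbidden S' t"
  using assms
proof (induction rule: forbidden.induct)
  case (comb e u a)
  then have "e \<in> S'" using num_ops_left_spine[of e u] by auto
  with comb show ?case by (auto intro: forbidden.comb)
qed (auto intro: forbidden.intros)

definition pattern_op :: "nat set \<Rightarrow> 'v trm list \<Rightarrow> 'v trm" where
  "pattern_op S ts = (if forbidden S (Op ts) then Op [] else Op ts)"

lemma terms_2_Op:
  assumes "length ts = 2" obtains a b where "ts = [a, b]"
  using assms by (auto simp: numeral_2_eq_2 length_Suc_conv)

text \<open>A forbidden argument makes the result forbidden under both operations. Otherwise the
  arguments agree, and \<open>pattern_op\<close> deviates from \<open>Op\<close> only by replacing a
  forbidden result with \<open>Op []\<close>, which is forbidden too.\<close>

lemma eval_pattern_op:
  assumes "t \<in> terms 2"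
  shows "(forbidden S (eval_trm (pattern_op S) h t) \<longleftrightarrow> forbidden S (eval_trm Op h t)) \<and>
    (\<not> forbidden S (eval_trm Op h t) \<longrightarrow> eval_trm (pattern_op S) h t = eval_trm Op h t)"
  using assms
proof induction
  case (Op ts)
  from Op(1) obtain a b where ts: "ts = [a, b]" by (rule terms_2_Op)
  show ?case
  proof (cases "forbidden S (eval_trm Op h a) \<or> forbidden S (eval_trm Op h b)")
    case True
    with Op ts show ?thesis by (auto simp: pattern_op_def intro: forbidden.intros)
  next
    case False
    with Op ts show ?thesis by (auto simp: pattern_op_def intro: forbidden.intros)
  qed
qed simp

text \<open>As \<open>t\<close> is not a variable, its value is an output of
  \<open>pattern_op\<close>, whose only forbidden output is \<open>Op []\<close>.\<close>

lemma eval_pattern_op_forbidden: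
  assumes "t \<in> terms 2" "forbidden S t"
  shows "eval_trm (pattern_op S) h t = Op []"
proof -
  have "forbidden S (eval_trm (pattern_op S) h t)"
    using eval_pattern_op[OF assms(1)] forbidden_subst[OF assms(2)] by blast
  moreover obtain ts where "t = Op ts"
    using assms(2) by (cases t) (auto elim: forbidden_VarE)
  ultimately show ?thesis by (auto simp: pattern_op_def split: if_splits)
qed

text \<open>Constant assignments do not see the labels, which allows a bracketing to be recovered
  from its \<open>eps1\<close>.\<close>

lemma eval_label_const:
  fixes t :: "'v trm" and ts :: "'v trm list"
  shows "eval_trm f (\<lambda>_. c) (label k t) = eval_trm f (\<lambda>_. c) t"
    and "map (eval_trm f (\<lambda>_. c)) (label_list k ts) = map (eval_trm f (\<lambda>_. c)) ts"
  by (induction k t and k ts rule: label_label_list.induct) auto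

lemma eval_Op_Var [simp]: "eval_trm Op Var t = t"
  by (induction t) (auto intro: map_idI)

lemma eval_pattern_op_allowed:
  assumes "t \<in> bracketings 2" "\<not> forbidden S t"
  shows "eval_trm (pattern_op S) (\<lambda>_. Var ()) (eps1 t) = t"
  using eval_pattern_op[OF assms(1), of S Var] assms(2)
  by (simp add: eps1_def eval_label_const)

lemma satisfies_pattern_op:
  assumes "s \<in> bracketings 2" "t \<in> bracketings 2"
  shows "satisfies (UNIV :: bracketing set) (pattern_op S) (eps1 s) (eps1 t) \<longleftrightarrow>
    s = t \<or> forbidden S s \<and> forbidden S t" (is "?L \<longleftrightarrow> ?R")
proof
  have zero: "eval_trm (pattern_op S) h (eps1 u) = Op []"
    if "u \<in> bracketings 2" "forbidden S u" for u and h :: "nat \<Rightarrow> bracketing"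
    unfolding eps1_def
    by (intro eval_pattern_op_forbidden label_in_terms forbidden_label that)
  show "?R \<Longrightarrow> ?L" using assms zero by (auto simp: satisfies_def)
  assume ?L
  then have eq: "eval_trm (pattern_op S) (\<lambda>_. Var ()) (eps1 s)
    = eval_trm (pattern_op S) (\<lambda>_. Var ()) (eps1 t)"
    by (auto simp: satisfies_def)
  \<comment> \<open>If just one side were forbidden, the other would equal \<open>Op []\<close>,
    which is forbidden.\<close>
  show ?R
    using eq zero assms eval_pattern_op_allowed[of _ S]
    by (cases "forbidden S s"; cases "forbidden S t") (metis forbidden.zero)+
qed

text \<open>The forbidden bracketings form one class, nonempty because of \<open>b\<close>; it
  accounts for the \<open>Suc\<close>. All other classes are singletons.\<close>

lemma spectrum_pattern_op:
  assumes "b \<in> bracketings_of_size 2 n" "forbidden S b"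
  shows "spectrum 2 (UNIV :: bracketing set) (pattern_op S) n
    = Suc (card {t \<in> bracketings_of_size 2 n. \<not> forbidden S t})"
proof -
  let ?B = "bracketings_of_size 2 n"
  let ?G = "{t \<in> ?B. \<not> forbidden S t}" and ?F = "{t \<in> ?B. forbidden S t}"
  let ?\<sigma> = "sigma 2 (UNIV :: bracketing set) (pattern_op S) n"
  have cls: "?\<sigma> `` {t} = (if forbidden S t then ?F else {t})" if "t \<in> ?B" for t
    using that satisfies_pattern_op[of t _ S]
    by (auto simp: sigma_def bracketings_of_size_def)
  have "?B // ?\<sigma> = (\<lambda>t. ?\<sigma> `` {t}) ` (?F \<union> ?G)"
    by (auto simp: quotient_def)
  also have "\<dots> = insert ?F ((\<lambda>t. {t}) ` ?G)"
    unfolding image_Un using assms cls by (auto simp: image_iff)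
  finally have quot: "?B // ?\<sigma> = insert ?F ((\<lambda>t. {t}) ` ?G)" .
  have "?F \<notin> (\<lambda>t. {t}) ` ?G" by blast
  moreover have "finite ?G" by (simp add: finite_bracketings_of_size)
  ultimately show ?thesis
    unfolding spectrum_def quot by (simp add: card_image)
qed

abbreviation left_chain :: "nat \<Rightarrow> bracketing \<Rightarrow> bracketing" where
  "left_chain d u \<equiv> ((\<lambda>t. Op [t, Var ()]) ^^ d) u"

definition comb_tree :: "nat \<Rightarrow> bracketing" where
  "comb_tree d = Op [Var (), left_chain d (Op [Var (), Op [Var (), Var ()]])]"

lemma left_chain_in_terms: "u \<in> terms 2 \<Longrightarrow> left_chain d u \<in> terms 2"
  by (induction d) (auto intro!: terms.intros)

lemma num_ops_left_chain: "num_ops (left_chain d u) = d + num_ops u"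
  by (induction d) auto

lemma comb_tree_size: "comb_tree d \<in> bracketings_of_size 2 (d + 3)"
  by (auto simp: comb_tree_def bracketings_of_size_def num_ops_left_chain
      intro!: terms.intros left_chain_in_terms)

text \<open>Along the left edge only the node at depth \<open>d\<close> has a composite second
  argument. This keeps combs of different index apart.\<close>

lemma left_spine_left_chain:
  "left_spine e (left_chain d (Op [Var (), Op us])) \<longleftrightarrow> e = d"
proof (induction d arbitrary: e)
  case 0
  show ?case by (auto elim!: left_spine_OpE left_spine_VarE intro: left_spine_0)
next
  case (Suc d)
  then show ?case by (auto elim!: left_spine_OpE intro: left_spine_Suc)
qed

text \<open>No node has two composite arguments, and the only composite second argument,
  \<open>Op [Var (), Var ()]\<close>, has no left spine.\<close>

lemma not_forbidden_left_chain:
  "\<not> forbidden S (left_chain d (Op [Var (), Op [Var (), Var ()]]))"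
  by (induction d)
    (auto elim!: forbidden_OpE forbidden_VarE left_spine_OpE left_spine_VarE)

lemma forbidden_comb_tree: "forbidden S (comb_tree d) \<longleftrightarrow> d \<in> S"
  using not_forbidden_left_chain[of S d]
  by (auto simp: comb_tree_def left_spine_left_chain
      elim!: forbidden_OpE forbidden_VarE intro: forbidden.comb)

text \<open>This is the purpose of the pattern (xx)(xx): a lone forbidden bracketing would be a
  singleton class like any allowed one, and forbidding it would not change the spectrum.\<close>

lemma ex_forbidden: "\<exists>b \<in> bracketings_of_size 2 (d + 3). forbidden S b"
proof
  let ?c = "Op [Var (), Var ()]"
  show "Op [?c, left_chain d ?c] \<in> bracketings_of_size 2 (d + 3)"
    by (auto simp: bracketings_of_size_def num_ops_left_chain
        intro!: terms.intros left_chain_in_terms)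
  show "forbidden S (Op [?c, left_chain d ?c])"
    by (cases d) (auto intro: forbidden.branch)
qed

lemma spectrum_pattern_op_less:
  assumes "S \<inter> {..<d} = S' \<inter> {..<d}" "d \<in> S'" "d \<notin> S"
  shows "spectrum 2 (UNIV :: bracketing set) (pattern_op S') (d + 3)
    < spectrum 2 (UNIV :: bracketing set) (pattern_op S) (d + 3)"
proof -
  let ?G = "\<lambda>S. {t \<in> bracketings_of_size 2 (d + 3). \<not> forbidden S t}"
  \<comment> \<open>Since \<open>d\<close> is not in \<open>S\<close>, all combs of \<open>S\<close>
    that fit into size \<open>d + 3\<close> are also combs of \<open>S'\<close>.\<close>
  have "S \<inter> {..d} = S' \<inter> {..<d}"
    unfolding assms(1)[symmetric] using assms(3) by (auto simp: le_less)
  then have "S \<inter> {..d} \<subseteq> S'" by blast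
  then have "forbidden S' t" if "forbidden S t" "t \<in> bracketings_of_size 2 (d + 3)" for t
    using forbidden_mono_upto[of S t d S'] that by (auto simp: bracketings_of_size_def)
  then have "?G S' \<subseteq> ?G S" by blast
  moreover have "comb_tree d \<in> ?G S - ?G S'"
    using assms(2,3) comb_tree_size by (auto simp: forbidden_comb_tree)
  ultimately have "card (?G S') < card (?G S)"
    by (intro psubset_card_mono) (auto simp: finite_bracketings_of_size)
  moreover have "spectrum 2 (UNIV :: bracketing set) (pattern_op T) (d + 3) = Suc (card (?G T))"
    for T
    using ex_forbidden[of d T] spectrum_pattern_op by blast
  ultimately show ?thesis by (simp only: Suc_less_eq)
qed

lemma inj_spectrum_pattern_op:
  "inj (\<lambda>S. spectrum 2 (UNIV :: bracketing set) (pattern_op S))"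
proof (rule injI, rule ccontr)
  fix S S' :: "nat set"
  assume eq: "spectrum 2 (UNIV :: bracketing set) (pattern_op S)
    = spectrum 2 (UNIV :: bracketing set) (pattern_op S')"
    and "S \<noteq> S'"
  then obtain e where e: "(e \<in> S) \<noteq> (e \<in> S')" by (meson subsetI subset_antisym)
  define d where "d = (LEAST d. (d \<in> S) \<noteq> (d \<in> S'))"
  have d: "(d \<in> S) \<noteq> (d \<in> S')"
    unfolding d_def using e by (rule LeastI)
  have "i \<in> S \<longleftrightarrow> i \<in> S'" if "i < d" for i
    using not_less_Least[OF that[unfolded d_def]] by simp
  then have below: "S \<inter> {..<d} = S' \<inter> {..<d}" by auto
  show False
  proof (cases "d \<in> S")
    case True
    with d spectrum_pattern_op_less[OF below[symmetric]] show False by (simp add: eq)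
  next
    case False
    with d spectrum_pattern_op_less[OF below] show False by (simp add: eq)
  qed
qed

text \<open>A function is determined by its graph, coded as a set of numbers.\<close>

lemma lepoll_nat_fun_nat_set: "(UNIV :: (nat \<Rightarrow> nat) set) \<lesssim> (UNIV :: nat set set)"
proof -
  have "inj (\<lambda>g :: nat \<Rightarrow> nat. prod_encode ` range (\<lambda>n. (n, g n)))"
    by (rule injI, subst (asm) inj_image_eq_iff[OF inj_prod_encode]) (auto simp: fun_eq_iff)
  then show ?thesis unfolding lepoll_def by blast
qed

theorem theorem6p5:
  assumes "infinite (UNIV :: 'a set)"
  shows "associative_spectra TYPE('a) \<approx> (UNIV :: nat set set)"
proof (rule lepoll_antisym)
  show "associative_spectra TYPE('a) \<lesssim> (UNIV :: nat set set)"
    using subset_imp_lepoll[OF subset_UNIV] lepoll_nat_fun_nat_set by (rule lepoll_trans)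
  have "spectrum 2 (UNIV :: bracketing set) (pattern_op S) \<in> associative_spectra TYPE(bracketing)"
    for S
    unfolding associative_spectra_def groupoid_def by blast
  \<comment> \<open>The witnesses live on \<open>bracketing\<close>; as \<open>'a\<close> is
    infinite, their spectra also arise over \<open>'a\<close>.\<close>
  then have "range (\<lambda>S. spectrum 2 (UNIV :: bracketing set) (pattern_op S))
    \<subseteq> associative_spectra TYPE('a)"
    using associative_spectra_subset[OF assms, where 'b = bracketing] by blast
  then show "(UNIV :: nat set set) \<lesssim> associative_spectra TYPE('a)"
    unfolding lepoll_def using inj_spectrum_pattern_op by blast
qed

end
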